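(* Let $q\ge 2$ and assume that a quantum error-correcting code $\mathcal{C}=(\!(n,K,d)\!)_q$ with $d>1$ exists. Then the following quantum error-correcting codes exist as well: (1) (subcode) a code $\mathcal{C}'=(\!(n,K',d)\!)_q$ for every integer $K'$ with $1<K'\le K$; (2) (lengthening) a code $\mathcal{C}'=(\!(n',K,d)\!)_q$ for every integer $n'\ge n$; (3) (puncturing) a code $\mathcal{C}'=(\!(n-1,K,d-1)\!)_q$.
   Context: The weight $\mathrm{wgt}(E)$ of a linear operator $E$ on $(\mathbb{C}^q)^{\otimes n}$ is the number of tensor factors (subsystems) on which it acts non-trivially, i.e. the smallest size of a set $T\subseteq\{1,\dots,n\}$ such that $E$ is the tensor product of the identity on the factors outside $T$ with some operator on the factors in $T$. A quantum error-correcting code $(\!(n,K,d)\!)_q$ is a complex linear subspace $\mathcal{C}\subseteq(\mathbb{C}^q)^{\otimes n}$ of dimension $K>1$ such that the Knill-Laflamme conditions hold for all pairs of linear operators $E_k,E_\ell$ on $(\mathbb{C}^q)^{\otimes n}$ with $\mathrm{wgt}(E_k^\dagger E_\ell)<d$: for an orthonormal basis $\{|c_i\rangle\}$ of $\mathcal{C}$, one has $\langle c_i|E_k^\dagger E_\ell|c_j\rangle=0$ for $i\neq j$, and $\langle c_i|E_k^\dagger E_\ell|c_i\rangle=\langle c_j|E_k^\dagger E_\ell|c_j\rangle$ for all $i,j$. Equivalently, $P_{\mathcal{C}}E_k^\dagger E_\ell P_{\mathcal{C}}=\alpha_{k\ell}P_{\mathcal{C}}$ for some scalar $\alpha_{k\ell}$,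 where $P_{\mathcal{C}}$ is the orthogonal projection onto $\mathcal{C}$. (So the parameter $d$ is a lower bound on the true minimum distance.) *)

theory Defs
  imports "Jordan_Normal_Form.Schur_Decomposition"
begin

text \<open>
  The space \<open>(\<complex>\<^sup>q)\<^sup>\<otimes>\<^sup>n\<close> is \<open>carrier_vec (q ^ n)\<close>: for \<open>q \<ge> 2\<close> the index
  \<open>i < q ^ n\<close> stands for the product basis vector whose factor number \<open>k < n\<close> (counting
  from 0) is the standard basis vector number \<open>digit q k i\<close>, the \<open>k\<close>-th base-\<open>q\<close> digit of
  \<open>i\<close>. Linear operators are matrices in this basis.
\<close>

definition digit :: "nat \<Rightarrow> nat \<Rightarrow> nat \<Rightarrow> nat" where
  "digit q k i = (i div q ^ k) mod q"

definition digits_on :: "nat \<Rightarrow> nat set \<Rightarrow> nat \<Rightarrow> (nat \<Rightarrow> nat)" where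
  "digits_on q T i = (\<lambda>k\<in>T. digit q k i)"

text \<open>
  An operator on the factors in a set \<open>T\<close> only is given by its matrix entries, indexed by
  pairs of digit assignments on \<open>T\<close>. For \<open>T = {}\<close> there is a single digit assignment, so
  such an operator is a scalar.
\<close>

type_synonym local_op = "(nat \<Rightarrow> nat) \<Rightarrow> (nat \<Rightarrow> nat) \<Rightarrow> complex"

definition local_id :: local_op where
  "local_id x y = (if x = y then 1 else 0)"

text \<open>The operator \<open>A \<otimes> B\<close>, with \<open>A\<close> acting on the factors in \<open>T\<close> and \<open>B\<close> on the others.\<close>

definition tensor_op :: "nat \<Rightarrow> nat \<Rightarrow> nat set \<Rightarrow> local_op \<Rightarrow> local_op \<Rightarrow> complex mat" where
  "tensor_op q n T A B = mat (q ^ n) (q ^ n) (\<lambda>(i, j).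
     A (digits_on q T i) (digits_on q T j) *
     B (digits_on q ({..<n} - T) i) (digits_on q ({..<n} - T) j))"

definition wgt :: "nat \<Rightarrow> nat \<Rightarrow> complex mat \<Rightarrow> nat" where
  "wgt q n E =
     (LEAST t. \<exists>T A. T \<subseteq> {..<n} \<and> card T = t \<and> E = tensor_op q n T A local_id)"

text \<open>\<open>\<langle>u|E|v\<rangle>\<close>, conjugate-linear in \<open>u\<close>; note that \<open>\<bullet>c\<close> conjugates its second argument.\<close>

definition braket :: "complex vec \<Rightarrow> complex mat \<Rightarrow> complex vec \<Rightarrow> complex" where
  "braket u E v = (E *\<^sub>v v) \<bullet>c u"

abbreviation qudits :: "nat \<Rightarrow> nat \<Rightarrow> (complex, complex vec) module" where
  "qudits q n \<equiv> module_vec TYPE(complex) (q ^ n)"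

definition orthonormal_basis ::
    "nat \<Rightarrow> nat \<Rightarrow> complex vec set \<Rightarrow> complex vec list \<Rightarrow> bool" where
  "orthonormal_basis q n C cs \<longleftrightarrow>
     vectorspace.basis class_ring (qudits q n\<lparr>carrier := C\<rparr>) (set cs) \<and>
     (\<forall>i<length cs. \<forall>j<length cs. (cs ! j) \<bullet>c (cs ! i) = (if i = j then 1 else 0))"

definition knill_laflamme ::
    "nat \<Rightarrow> nat \<Rightarrow> nat \<Rightarrow> complex vec list \<Rightarrow> bool" where
  "knill_laflamme q n d cs \<longleftrightarrow>
     (\<forall>E \<in> carrier_mat (q ^ n) (q ^ n). \<forall>F \<in> carrier_mat (q ^ n) (q ^ n).
        wgt q n (mat_adjoint E * F) < d \<longrightarrow>
        (\<forall>i<length cs. \<forall>j<length cs.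
           (i \<noteq> j \<longrightarrow> braket (cs ! i) (mat_adjoint E * F) (cs ! j) = 0) \<and>
           braket (cs ! i) (mat_adjoint E * F) (cs ! i) =
             braket (cs ! j) (mat_adjoint E * F) (cs ! j)))"

text \<open>\<open>qecc q n K d C\<close>: the subspace \<open>C\<close> is a code with parameters \<open>((n, K, d))\<^sub>q\<close>.\<close>

definition qecc :: "nat \<Rightarrow> nat \<Rightarrow> nat \<Rightarrow> nat \<Rightarrow> complex vec set \<Rightarrow> bool" where
  "qecc q n K d C \<longleftrightarrow>
     VectorSpace.subspace class_ring C (qudits q n) \<and>
     vectorspace.dim class_ring (qudits q n\<lparr>carrier := C\<rparr>) = K \<and> K > 1 \<and>
     (\<exists>cs. orthonormal_basis q n C cs \<and> knill_laflamme q n d cs)"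

end

theory Submission
  imports Defs
begin

text \<open>
  The Knill-Laflamme conditions need only be checked for operators \<open>A \<otimes> I\<close> with \<open>A\<close> acting on
  fewer than \<open>d\<close> factors, and each of the three codes is given by an orthonormal list of
  vectors. For a subcode, take an initial part of the basis. For lengthening, append factors
  in the state \<open>|0\<rangle>\<close>: on \<open>u \<otimes> |0\<rangle>\<close> an operator of weight below \<open>d\<close> acts through one of its
  diagonal blocks, whose weight is no larger. For puncturing, project the last factor onto a
  basis state \<open>|a\<rangle>\<close>. An operator \<open>M\<close> on the punctured space corresponds to
  \<open>M \<otimes> |a\<rangle>\<langle>a|\<close>, of weight at most \<open>wgt M + 1 < d\<close>, so the projected vectors satisfy the
  conditions for \<open>d - 1\<close>; since \<open>d > 1\<close>, the case \<open>M = I\<close> shows that they are orthogonal and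
  all of the same norm. This norm is nonzero for at least one \<open>a\<close>, and normalisation gives
  the code.
\<close>

section \<open>Codes as orthonormal lists\<close>

definition orthonormal :: "complex vec list \<Rightarrow> bool" where
  "orthonormal cs \<longleftrightarrow>
     (\<forall>i<length cs. \<forall>j<length cs. (cs ! j) \<bullet>c (cs ! i) = (if i = j then 1 else 0))"

text \<open>The Knill-Laflamme condition for a single operator: for orthonormal \<open>cs\<close>,
  the compression of \<open>M\<close> to their span is a multiple of the identity.\<close>

definition scalar_on :: "complex vec list \<Rightarrow> complex mat \<Rightarrow> bool" where
  "scalar_on cs M \<longleftrightarrow>
     (\<forall>i<length cs. \<forall>j<length cs.
        (i \<noteq> j \<longrightarrow> braket (cs ! i) M (cs ! j) = 0) \<and>
        braket (cs ! i) M (cs ! i) = braket (cs ! j) M (cs ! j))"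

lemma knill_laflamme_altdef:
  "knill_laflamme q n d cs \<longleftrightarrow>
     (\<forall>E \<in> carrier_mat (q ^ n) (q ^ n). \<forall>F \<in> carrier_mat (q ^ n) (q ^ n).
        wgt q n (mat_adjoint E * F) < d \<longrightarrow> scalar_on cs (mat_adjoint E * F))"
  unfolding knill_laflamme_def scalar_on_def ..

lemma orthonormal_distinct:
  assumes "orthonormal cs"
  shows "distinct cs"
  unfolding distinct_conv_nth
proof (intro allI impI notI)
  fix i j assume "i < length cs" "j < length cs" "i \<noteq> j" "cs ! i = cs ! j"
  then show False
    using assms unfolding orthonormal_def by (metis zero_neq_one)
qed

lemma orthonormal_lin_indpt:
  assumes "orthonormal cs" "set cs \<subseteq> carrier_vec N"
  shows "\<not> module.lin_dep class_ring (module_vec TYPE(complex) N) (set cs)"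
proof -
  interpret vec_space "TYPE(complex)" N .
  show ?thesis
  proof (rule finite_lin_indpt2)
    fix f :: "complex vec \<Rightarrow> complex"
    assume zero: "lincomb f (set cs) = 0\<^sub>v N"
    show "\<forall>v\<in>set cs. f v = 0"
    proof
      fix v assume v: "v \<in> set cs"
      then obtain i where i: "i < length cs" "v = cs ! i"
        by (metis in_set_conv_nth)
      have vN: "v \<in> carrier_vec N" using v assms(2) by auto
      \<comment> \<open>Pairing with \<open>v\<close> isolates the coefficient \<open>f v\<close>:
        the other vectors are orthogonal to \<open>v\<close>, which has norm 1.\<close>
      have "0 = lincomb f (set cs) \<bullet>c v"
        using zero vN by (simp add: module_vec_simps)
      also have "\<dots> = (\<Sum>u\<in>set cs. (f u \<cdot>\<^sub>v u) \<bullet>c v)"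
        unfolding lincomb_def using assms(2) vN
        by (subst finsum_scalar_prod_sum) (auto simp: module_vec_simps)
      also have "\<dots> = (\<Sum>u\<in>set cs. if u = v then f u else 0)"
      proof (rule sum.cong)
        fix u assume u: "u \<in> set cs"
        then obtain j where j: "j < length cs" "u = cs ! j"
          by (metis in_set_conv_nth)
        have "u \<bullet>c v = (if u = v then 1 else 0)"
          using assms(1) i j unfolding orthonormal_def by (metis zero_neq_one)
        moreover have "(f u \<cdot>\<^sub>v u) \<bullet>c v = f u * (u \<bullet>c v)"
          using u vN assms(2) by (intro smult_scalar_prod_distrib[of _ N]) auto
        ultimately show "(f u \<cdot>\<^sub>v u) \<bullet>c v = (if u = v then f u else 0)" by simp
      qed simp
      also have "\<dots> = f v" using v by simp
      finally show "f v = 0" by simp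
    qed
  qed (use assms(2) in \<open>auto simp: module_vec_simps\<close>)
qed

text \<open>An orthonormal basis has no repeated entries, so its length is the dimension;
  conversely, the span of an orthonormal list is the code. This lets the constructions work with
  lists of vectors only.\<close>

lemma ex_qecc_iff:
  "(\<exists>C. qecc q n K d C) \<longleftrightarrow>
     K > 1 \<and> (\<exists>cs. length cs = K \<and> set cs \<subseteq> carrier_vec (q ^ n) \<and>
                   orthonormal cs \<and> knill_laflamme q n d cs)"
  (is "?L \<longleftrightarrow> ?R")
proof -
  interpret V: vec_space "TYPE(complex)" "q ^ n" .
  show ?thesis
  proof
    assume ?L
    then obtain C cs where sub: "VectorSpace.subspace class_ring C (qudits q n)"
      and dim: "vectorspace.dim class_ring (qudits q n\<lparr>carrier := C\<rparr>) = K"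
      and K: "K > 1" and ob: "orthonormal_basis q n C cs" and kl: "knill_laflamme q n d cs"
      unfolding qecc_def by blast
    interpret W: vectorspace class_ring "qudits q n\<lparr>carrier := C\<rparr>"
      by (rule V.subspace_is_vs[OF sub])
    have basis: "W.basis (set cs)" and on: "orthonormal cs"
      using ob unfolding orthonormal_basis_def orthonormal_def by auto
    have "set cs \<subseteq> C" using basis unfolding W.basis_def by auto
    moreover have "C \<subseteq> carrier_vec (q ^ n)"
      using sub unfolding VectorSpace.subspace_def submodule_def by (auto simp: module_vec_simps)
    moreover have "card (set cs) = K"
      using W.dim_basis[OF _ basis] dim by simp
    ultimately show ?R
      using K on kl orthonormal_distinct[OF on] distinct_card[of cs] by auto
  next
    assume ?R
    then obtain cs where K: "K > 1" "length cs = K" and car: "set cs \<subseteq> carrier_vec (q ^ n)"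
      and on: "orthonormal cs" and kl: "knill_laflamme q n d cs" by blast
    let ?C = "V.span (set cs)"
    have sub: "VectorSpace.subspace class_ring ?C (qudits q n)"
      by (rule V.span_is_subspace[OF car])
    have subm: "submodule class_ring ?C (qudits q n)"
      by (rule V.span_is_submodule[OF car])
    have inC: "set cs \<subseteq> ?C" by (rule V.in_own_span[OF car])
    interpret W: vectorspace class_ring "qudits q n\<lparr>carrier := ?C\<rparr>"
      by (rule V.subspace_is_vs[OF sub])
    \<comment> \<open>Linear independence and span are the same inside the subspace as in the
      ambient space.\<close>
    have basis: "W.basis (set cs)"
      unfolding W.basis_def
      using V.span_li_not_depend[OF inC subm] orthonormal_lin_indpt[OF on car] inC by simp
    have "W.dim = K"
      using W.dim_basis[OF _ basis] distinct_card[OF orthonormal_distinct[OF on]] K by simp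
    then have "qecc q n K d ?C"
      unfolding qecc_def orthonormal_basis_def
      using sub K basis on[unfolded orthonormal_def] kl by blast
    then show ?L by blast
  qed
qed

section \<open>Base-\<open>q\<close> digits\<close>

lemma mod_power_eqI:
  assumes "\<And>k. k < n \<Longrightarrow> digit q k i = digit q k j"
  shows "i mod q ^ n = j mod q ^ n"
  using assms
proof (induction n)
  case (Suc n)
  then have "i mod q ^ n = j mod q ^ n" "i div q ^ n mod q = j div q ^ n mod q"
    unfolding digit_def by auto
  then show ?case
    by (simp add: power_Suc2 mod_mult2_eq del: power_Suc)
qed simp

lemma digits_on_eq_iff:
  "digits_on q T i = digits_on q T j \<longleftrightarrow> (\<forall>k\<in>T. digit q k i = digit q k j)"
  unfolding digits_on_def fun_eq_iff restrict_def by auto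

lemma digits_on_all_eq_iff:
  assumes "i < q ^ n" "j < q ^ n"
  shows "digits_on q {..<n} i = digits_on q {..<n} j \<longleftrightarrow> i = j"
  using mod_power_eqI[of n q i j] assms by (auto simp: digits_on_eq_iff)

lemma digit_eq_0:
  assumes "i < q ^ n" "n \<le> k"
  shows "digit q k i = 0"
proof (cases "q = 0")
  case False
  then have "q ^ n \<le> q ^ k" using assms by (intro power_increasing) auto
  then show ?thesis using assms unfolding digit_def by simp
\<comment> \<open>For \<open>q = 0\<close> the bound forces \<open>n = 0\<close> and
  \<open>i = 0\<close>.\<close>
qed (use assms in \<open>auto simp: digit_def power_0_left split: if_splits\<close>)

lemma digit_last:
  assumes "i < q ^ Suc m"
  shows "digit q m i = i div q ^ m"
  using assms unfolding digit_def
  by (intro mod_less less_mult_imp_div_less) simp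

text \<open>\<open>q ^ m\<close> is a multiple of \<open>q ^ Suc k\<close>, so adding
  \<open>a * q ^ m\<close> changes the quotient by \<open>q ^ k\<close> by a multiple of
  \<open>q\<close>.\<close>

lemma digit_add_last:
  assumes "k < m" "q > 0"
  shows "digit q k (i + a * q ^ m) = digit q k i"
proof -
  obtain r where m: "m = Suc (k + r)" using assms less_iff_Suc_add by blast
  have "(i + a * q ^ m) div q ^ k = (i + (a * q ^ r * q) * q ^ k) div q ^ k"
    unfolding m by (simp add: power_add mult_ac)
  also have "\<dots> = i div q ^ k + (a * q ^ r) * q"
    using assms by simp
  finally show ?thesis unfolding digit_def by (simp only: mod_mult_self1)
qed

section \<open>Local operators and weight\<close>

lemma tensor_op_carrier [simp]: "tensor_op q n T A B \<in> carrier_mat (q ^ n) (q ^ n)"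
  unfolding tensor_op_def by simp

lemma tensor_op_index:
  assumes "i < q ^ n" "j < q ^ n"
  shows "tensor_op q n T A local_id $$ (i, j) =
    (if \<forall>k\<in>{..<n} - T. digit q k i = digit q k j
     then A (digits_on q T i) (digits_on q T j) else 0)"
  using assms unfolding tensor_op_def local_id_def by (simp add: digits_on_eq_iff)

text \<open>On the empty set the first factor is the scalar 1, and \<open>local_id\<close> on all
  digits compares the indices. Inner products thus become brakets of an operator supported on no
  factor.\<close>

lemma tensor_op_empty: "tensor_op q n {} (\<lambda>_ _. 1) local_id = 1\<^sub>m (q ^ n)"
  using digits_on_all_eq_iff[of _ q n]
  by (intro eq_matI) (auto simp: tensor_op_def local_id_def)

text \<open>Ensures that the minimum defining \<open>wgt\<close> is taken over a nonempty
  set.\<close>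

lemma ex_tensor_op:
  assumes "M \<in> carrier_mat (q ^ n) (q ^ n)"
  shows "\<exists>A. M = tensor_op q n {..<n} A local_id"
proof -
  \<comment> \<open>\<open>?g\<close> recovers the index from its digit assignment.\<close>
  let ?g = "inv_into {..<q ^ n} (digits_on q {..<n})"
  have "inj_on (digits_on q {..<n}) {..<q ^ n}"
    by (rule inj_onI) (simp add: digits_on_all_eq_iff)
  then have "M = tensor_op q n {..<n} (\<lambda>x y. M $$ (?g x, ?g y)) local_id"
    using assms by (intro eq_matI) (auto simp: tensor_op_def local_id_def digits_on_eq_iff)
  then show ?thesis by blast
qed

lemma wgt_tensor_op_le:
  assumes "T \<subseteq> {..<n}"
  shows "wgt q n (tensor_op q n T A local_id) \<le> card T"
  unfolding wgt_def by (rule Least_le) (use assms in blast)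

lemma wgt_tensor_opE:
  assumes "M \<in> carrier_mat (q ^ n) (q ^ n)"
  obtains T A where "T \<subseteq> {..<n}" "card T = wgt q n M" "M = tensor_op q n T A local_id"
proof -
  have "\<exists>t T A. T \<subseteq> {..<n} \<and> card T = t \<and> M = tensor_op q n T A local_id"
    using ex_tensor_op[OF assms] by blast
  then show ?thesis
    using that LeastI_ex[of "\<lambda>t. \<exists>T A. T \<subseteq> {..<n} \<and> card T = t \<and> M = tensor_op q n T A local_id"]
    unfolding wgt_def by blast
qed

lemma mat_adjoint_one: "mat_adjoint (1\<^sub>m N :: complex mat) = 1\<^sub>m N"
  by (rule eq_matI) (auto simp: mat_adjoint_def mat_of_rows_def)

text \<open>Products \<open>mat_adjoint E * F\<close> cover all operators, as \<open>E\<close> may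
  be the identity. One direction uses that \<open>wgt\<close> is at most \<open>card T\<close>, the
  other takes \<open>T\<close> of minimal size.\<close>

lemma knill_laflamme_iff:
  "knill_laflamme q n d cs \<longleftrightarrow>
     (\<forall>T A. T \<subseteq> {..<n} \<longrightarrow> card T < d \<longrightarrow> scalar_on cs (tensor_op q n T A local_id))"
proof (intro iffI allI impI)
  fix T A assume kl: "knill_laflamme q n d cs" and T: "T \<subseteq> {..<n}" "card T < d"
  let ?M = "tensor_op q n T A local_id"
  have "wgt q n ?M < d" using wgt_tensor_op_le[OF T(1)] T(2) by (rule le_less_trans)
  moreover have "mat_adjoint (1\<^sub>m (q ^ n)) * ?M = ?M"
    unfolding mat_adjoint_one by (rule left_mult_one_mat[OF tensor_op_carrier])
  ultimately show "scalar_on cs ?M"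
    using kl unfolding knill_laflamme_altdef by (metis one_carrier_mat tensor_op_carrier)
next
  assume *: "\<forall>T A. T \<subseteq> {..<n} \<longrightarrow> card T < d \<longrightarrow> scalar_on cs (tensor_op q n T A local_id)"
  show "knill_laflamme q n d cs"
    unfolding knill_laflamme_altdef
  proof (intro ballI impI)
    fix E F :: "complex mat"
    assume EF: "E \<in> carrier_mat (q ^ n) (q ^ n)" "F \<in> carrier_mat (q ^ n) (q ^ n)"
      and w: "wgt q n (mat_adjoint E * F) < d"
    have "mat_adjoint E * F \<in> carrier_mat (q ^ n) (q ^ n)"
      using EF unfolding mat_adjoint_def by (auto simp: mat_of_rows_def)
    then obtain T A where "T \<subseteq> {..<n}" "card T = wgt q n (mat_adjoint E * F)"
      "mat_adjoint E * F = tensor_op q n T A local_id"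
      by (rule wgt_tensor_opE)
    with * w show "scalar_on cs (mat_adjoint E * F)" by metis
  qed
qed

section \<open>Matrix elements in coordinates\<close>

lemma cscalar_prod_sum:
  assumes "u \<in> carrier_vec N" "v \<in> carrier_vec N"
  shows "u \<bullet>c v = (\<Sum>i<N. u $ i * cnj (v $ i))"
  using carrier_vecD[OF assms(1)] carrier_vecD[OF assms(2)]
  unfolding scalar_prod_def by (auto simp: atLeast0LessThan conjugate_complex_def intro!: sum.cong)

lemma braket_sum:
  assumes "u \<in> carrier_vec N" "v \<in> carrier_vec N" "M \<in> carrier_mat N N"
  shows "braket u M v = (\<Sum>i<N. \<Sum>j<N. M $$ (i, j) * v $ j * cnj (u $ i))"
proof -
  have "braket u M v = (\<Sum>i<N. (M *\<^sub>v v) $ i * cnj (u $ i))"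
    unfolding braket_def by (rule cscalar_prod_sum) (use assms in auto)
  also have "\<dots> = (\<Sum>i<N. \<Sum>j<N. M $$ (i, j) * v $ j * cnj (u $ i))"
  proof (rule sum.cong)
    fix i assume "i \<in> {..<N}"
    then have "(M *\<^sub>v v) $ i = (\<Sum>j<N. M $$ (i, j) * v $ j)"
      using carrier_vecD[OF assms(2)] carrier_matD[OF assms(3)]
      by (auto simp: scalar_prod_def atLeast0LessThan intro!: sum.cong)
    then show "(M *\<^sub>v v) $ i * cnj (u $ i) = (\<Sum>j<N. M $$ (i, j) * v $ j * cnj (u $ i))"
      by (simp add: sum_distrib_right)
  qed simp
  finally show ?thesis .
qed

lemma braket_one:
  assumes "v \<in> carrier_vec N"
  shows "braket u (1\<^sub>m N) v = v \<bullet>c u"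
  using assms by (simp add: braket_def)

lemma braket_smult:
  assumes "u \<in> carrier_vec N" "v \<in> carrier_vec N" "M \<in> carrier_mat N N"
  shows "braket (s \<cdot>\<^sub>v u) M (t \<cdot>\<^sub>v v) = t * cnj s * braket u M v"
  using assms
  by (simp add: braket_sum[of _ N] sum_distrib_left)
    (intro sum.cong refl; simp add: mult_ac)

text \<open>A common factor \<open>c\<close> preserves both the zeros off the diagonal and the
  constant diagonal. Lengthening uses \<open>c = 1\<close>, puncturing the squared modulus of the
  normalising factor.\<close>

lemma scalar_on_mapI:
  assumes "\<And>u v. u \<in> set cs \<Longrightarrow> v \<in> set cs \<Longrightarrow> braket (f u) M (f v) = c * braket u N v"
    and "scalar_on cs N"
  shows "scalar_on (map f cs) M"
  unfolding scalar_on_def length_map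
proof (intro allI impI)
  fix i j assume ij: "i < length cs" "j < length cs"
  have eq: "braket (map f cs ! k) M (map f cs ! l) = c * braket (cs ! k) N (cs ! l)"
    if "k < length cs" "l < length cs" for k l
    using that assms(1) by simp
  show "(i \<noteq> j \<longrightarrow> braket (map f cs ! i) M (map f cs ! j) = 0) \<and>
      braket (map f cs ! i) M (map f cs ! i) = braket (map f cs ! j) M (map f cs ! j)"
    unfolding eq[OF ij] eq[OF ij(1) ij(1)] eq[OF ij(2) ij(2)]
    using assms(2) ij unfolding scalar_on_def by (metis mult_zero_right)
qed

section \<open>Subcodes\<close>

lemma orthonormal_take:
  assumes "orthonormal cs"
  shows "orthonormal (take k cs)"
  using assms unfolding orthonormal_def by simp

lemma scalar_on_take:
  assumes "scalar_on cs M"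
  shows "scalar_on (take k cs) M"
  unfolding scalar_on_def
proof (intro allI impI)
  fix i j assume "i < length (take k cs)" "j < length (take k cs)"
  then show "(i \<noteq> j \<longrightarrow> braket (take k cs ! i) M (take k cs ! j) = 0) \<and>
      braket (take k cs ! i) M (take k cs ! i) = braket (take k cs ! j) M (take k cs ! j)"
    using assms[unfolded scalar_on_def, rule_format, of i j] by simp
qed

lemma knill_laflamme_take:
  assumes "knill_laflamme q n d cs"
  shows "knill_laflamme q n d (take k cs)"
  using assms scalar_on_take unfolding knill_laflamme_altdef by blast

theorem ex_qecc_subcode:
  assumes "qecc q n K d C" "1 < K'" "K' \<le> K"
  shows "\<exists>C'. qecc q n K' d C'"
proof -
  from assms(1) have "\<exists>C. qecc q n K d C" by blast
  then obtain cs where "length cs = K" "set cs \<subseteq> carrier_vec (q ^ n)"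
    "orthonormal cs" "knill_laflamme q n d cs"
    unfolding ex_qecc_iff by blast
  then have "length (take K' cs) = K' \<and> set (take K' cs) \<subseteq> carrier_vec (q ^ n) \<and>
      orthonormal (take K' cs) \<and> knill_laflamme q n d (take K' cs)"
    using assms(3) set_take_subset[of K' cs]
    by (auto intro: orthonormal_take knill_laflamme_take)
  then show ?thesis using assms(2) unfolding ex_qecc_iff by blast
qed

section \<open>Lengthening\<close>

text \<open>The appended factors are the high digits, so indices below \<open>q ^ n\<close> are
  those whose new digits are all 0. Padding with zeros is therefore tensoring with |0...0>.\<close>

definition pad_vec :: "nat \<Rightarrow> complex vec \<Rightarrow> complex vec" where
  "pad_vec N u = vec N (\<lambda>i. if i < dim_vec u then u $ i else 0)"

lemma pad_vec_carrier [simp]: "pad_vec N u \<in> carrier_vec N"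
  unfolding pad_vec_def by simp

lemma sum_pad:
  fixes g :: "nat \<Rightarrow> 'a :: comm_monoid_add"
  assumes "M \<le> N" "\<And>i. M \<le> i \<Longrightarrow> i < N \<Longrightarrow> f i = 0" "\<And>i. i < M \<Longrightarrow> f i = g i"
  shows "sum f {..<N} = sum g {..<M :: nat}"
  using assms by (intro sum.mono_neutral_cong_right) auto

lemma pad_vec_cscalar_prod:
  assumes "u \<in> carrier_vec M" "v \<in> carrier_vec M" "M \<le> N"
  shows "pad_vec N u \<bullet>c pad_vec N v = u \<bullet>c v"
  unfolding cscalar_prod_sum[OF pad_vec_carrier pad_vec_carrier] cscalar_prod_sum[OF assms(1,2)]
  using assms by (intro sum_pad) (auto simp: pad_vec_def)

text \<open>Padded vectors vanish from index \<open>M\<close> on, so only the top left block of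
  \<open>A\<close> enters the double sum.\<close>

lemma braket_pad_vec:
  assumes "u \<in> carrier_vec M" "v \<in> carrier_vec M" "M \<le> N"
    and A: "A \<in> carrier_mat N N" "B \<in> carrier_mat M M"
    and eq: "\<And>i j. i < M \<Longrightarrow> j < M \<Longrightarrow> A $$ (i, j) = B $$ (i, j)"
  shows "braket (pad_vec N u) A (pad_vec N v) = braket u B v"
  unfolding braket_sum[OF pad_vec_carrier pad_vec_carrier A(1)] braket_sum[OF assms(1,2) A(2)]
  using assms by (intro sum_pad) (auto simp: pad_vec_def intro!: sum_pad)

text \<open>With all new digits fixed to 0, the operator depends only on the old factors in
  \<open>T\<close>. The bounds by \<open>q ^ n'\<close> appear separately because
  \<open>q ^ n\<close> can exceed it when \<open>q = 0\<close>.\<close>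

lemma tensor_op_top_left_block:
  assumes "n \<le> n'" "T \<subseteq> {..<n'}"
  shows "\<exists>B. \<forall>i<q ^ n. \<forall>j<q ^ n. i < q ^ n' \<longrightarrow> j < q ^ n' \<longrightarrow>
    tensor_op q n' T A local_id $$ (i, j) = tensor_op q n (T \<inter> {..<n}) B local_id $$ (i, j)"
proof -
  \<comment> \<open>\<open>?e\<close> extends an assignment on the old factors in \<open>T\<close>
    by the digit 0 on the new ones.\<close>
  let ?e = "\<lambda>x. (\<lambda>k\<in>T. if k < n then x k else 0)"
  have e: "digits_on q T i = ?e (digits_on q (T \<inter> {..<n}) i)" if "i < q ^ n" for i
    using digit_eq_0[OF that] by (auto simp: digits_on_def restrict_def)
  \<comment> \<open>A new factor outside \<open>T\<close> has digit 0 in both indices and imposes no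
    condition.\<close>
  have id: "(\<forall>k\<in>{..<n'} - T. digit q k i = digit q k j) \<longleftrightarrow>
      (\<forall>k\<in>{..<n} - T \<inter> {..<n}. digit q k i = digit q k j)"
    if "i < q ^ n" "j < q ^ n" for i j
  proof (intro iffI ballI)
    fix k assume *: "\<forall>k\<in>{..<n} - T \<inter> {..<n}. digit q k i = digit q k j" and k: "k \<in> {..<n'} - T"
    show "digit q k i = digit q k j"
    proof (cases "k < n")
      case True
      with * k show ?thesis by simp
    next
      case False
      with that show ?thesis by (simp add: digit_eq_0)
    qed
  qed (use assms(1) in auto)
  show ?thesis
  proof (intro exI[of _ "\<lambda>x y. A (?e x) (?e y)"] allI impI)
    fix i j assume ij: "i < q ^ n" "j < q ^ n" "i < q ^ n'" "j < q ^ n'"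
    show "tensor_op q n' T A local_id $$ (i, j) =
        tensor_op q n (T \<inter> {..<n}) (\<lambda>x y. A (?e x) (?e y)) local_id $$ (i, j)"
      unfolding tensor_op_index[OF ij(1,2)] tensor_op_index[OF ij(3,4)] id[OF ij(1,2)]
        e[OF ij(1)] e[OF ij(2)] ..
  qed
qed

theorem ex_qecc_lengthen:
  assumes "q > 0" "qecc q n K d C" "n \<le> n'"
  shows "\<exists>C'. qecc q n' K d C'"
proof -
  from assms(2) have "\<exists>C. qecc q n K d C" by blast
  then obtain cs where K: "K > 1" "length cs = K" and car: "set cs \<subseteq> carrier_vec (q ^ n)"
    and on: "orthonormal cs" and kl: "knill_laflamme q n d cs"
    unfolding ex_qecc_iff by blast
  have le: "q ^ n \<le> q ^ n'" using assms(1,3) by (intro power_increasing) auto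
  let ?cs = "map (pad_vec (q ^ n')) cs"
  have "orthonormal ?cs"
    unfolding orthonormal_def length_map
  proof (intro allI impI)
    fix i j assume ij: "i < length cs" "j < length cs"
    then have "cs ! i \<in> carrier_vec (q ^ n)" "cs ! j \<in> carrier_vec (q ^ n)"
      using car by auto
    then show "?cs ! j \<bullet>c ?cs ! i = (if i = j then 1 else 0)"
      using ij le on by (simp add: pad_vec_cscalar_prod orthonormal_def)
  qed
  moreover have "knill_laflamme q n' d ?cs"
    unfolding knill_laflamme_iff
  proof (intro allI impI)
    fix T A assume T: "T \<subseteq> {..<n'}" "card T < d"
    obtain B where B: "\<And>i j. i < q ^ n \<Longrightarrow> j < q ^ n \<Longrightarrow>
        tensor_op q n' T A local_id $$ (i, j) = tensor_op q n (T \<inter> {..<n}) B local_id $$ (i, j)"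
      using tensor_op_top_left_block[OF assms(3) T(1)] le by (metis less_le_trans)
    have "card (T \<inter> {..<n}) \<le> card T"
      using T(1) by (intro card_mono) (auto intro: finite_subset)
    then have "scalar_on cs (tensor_op q n (T \<inter> {..<n}) B local_id)"
      using kl T(2) unfolding knill_laflamme_iff by auto
    then show "scalar_on ?cs (tensor_op q n' T A local_id)"
      by (rule scalar_on_mapI[where c = 1, rotated])
        (use car le B in \<open>auto intro!: braket_pad_vec\<close>)
  qed
  ultimately have "length ?cs = K \<and> set ?cs \<subseteq> carrier_vec (q ^ n') \<and>
      orthonormal ?cs \<and> knill_laflamme q n' d ?cs"
    using K by auto
  then show ?thesis using K(1) unfolding ex_qecc_iff by blast
qed

section \<open>Puncturing\<close>

text \<open>\<open>slice_vec N a u\<close> is \<open>(I \<otimes> \<langle>a|) u\<close>, where \<open>\<langle>a|\<close> acts on the last factor and \<open>N\<close> is the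
  dimension of the tensor product of the other factors.\<close>

definition slice_vec :: "nat \<Rightarrow> nat \<Rightarrow> complex vec \<Rightarrow> complex vec" where
  "slice_vec N a u = vec N (\<lambda>i. u $ (i + a * N))"

lemma slice_vec_carrier [simp]: "slice_vec N a u \<in> carrier_vec N"
  unfolding slice_vec_def by simp

lemma slice_index_less:
  fixes i a :: nat
  assumes "i < N" "a < q"
  shows "i + a * N < q * N"
proof -
  have "i + a * N < Suc a * N" using assms by simp
  also have "\<dots> \<le> q * N" using assms by (intro mult_right_mono) auto
  finally show ?thesis .
qed

text \<open>The indices \<open>i + a * N\<close> with \<open>i < N\<close> are exactly those with
  quotient \<open>a\<close> by \<open>N\<close>; elsewhere \<open>f\<close> vanishes.\<close>

lemma sum_slice:
  fixes g :: "nat \<Rightarrow> 'a :: comm_monoid_add"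
  assumes "a < q" "\<And>i. i < q * N \<Longrightarrow> i div N \<noteq> a \<Longrightarrow> f i = 0"
    and "\<And>i. i < N \<Longrightarrow> f (i + a * N) = g i"
  shows "sum f {..<q * N} = sum g {..<N}"
proof -
  have "sum f {..<q * N} = sum f ((\<lambda>i. i + a * N) ` {..<N})"
  proof (rule sum.mono_neutral_right)
    show "\<forall>i\<in>{..<q * N} - (\<lambda>i. i + a * N) ` {..<N}. f i = 0"
    proof
      fix i assume i: "i \<in> {..<q * N} - (\<lambda>i. i + a * N) ` {..<N}"
      then have less: "i < q * N" and notin: "i \<notin> (\<lambda>i. i + a * N) ` {..<N}" by blast+
      have "N > 0" using less by (metis gr0I mult_0_right not_less0)
      then have "i mod N \<in> {..<N}" by simp
      moreover have "i = i mod N + (i div N) * N" by simp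
      ultimately have "i div N \<noteq> a" using notin by blast
      then show "f i = 0" using assms(2) less by blast
    qed
  qed (use slice_index_less[OF _ assms(1)] in auto)
  also have "\<dots> = sum g {..<N}"
    using assms(3) by (subst sum.reindex) (auto intro!: inj_onI)
  finally show ?thesis .
qed

text \<open>\<open>A\<close> is \<open>B\<close> placed in diagonal block number \<open>a\<close>,
  with 0 elsewhere, so the double sum for \<open>A\<close> reduces to that block.\<close>

lemma braket_slice_vec:
  assumes "u \<in> carrier_vec (q * N)" "v \<in> carrier_vec (q * N)" "a < q"
    and A: "A \<in> carrier_mat (q * N) (q * N)" "B \<in> carrier_mat N N"
    and "\<And>i j. i < q * N \<Longrightarrow> j < q * N \<Longrightarrow> i div N \<noteq> a \<or> j div N \<noteq> a \<Longrightarrow> A $$ (i, j) = 0"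
    and "\<And>i j. i < N \<Longrightarrow> j < N \<Longrightarrow> A $$ (i + a * N, j + a * N) = B $$ (i, j)"
  shows "braket (slice_vec N a u) B (slice_vec N a v) = braket u A v"
  unfolding braket_sum[OF slice_vec_carrier slice_vec_carrier A(2)] braket_sum[OF assms(1,2) A(1)]
  using assms slice_index_less[OF _ assms(3)]
  by (intro sum_slice[symmetric] assms(3)) (auto simp: slice_vec_def intro!: sum_slice)

text \<open>Every entry of \<open>v\<close> lies in one of the \<open>q\<close> slices, so
  \<open>v\<close> would be 0 if all slices were.\<close>

lemma ex_slice_vec_nonzero:
  assumes "v \<in> carrier_vec (q * N)" "v \<bullet>c v \<noteq> 0"
  shows "\<exists>a<q. slice_vec N a v \<bullet>c slice_vec N a v \<noteq> 0"
proof (rule ccontr)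
  assume "\<not> ?thesis"
  then have z: "slice_vec N a v = 0\<^sub>v N" if "a < q" for a
    using that conjugate_square_eq_0_vec[OF slice_vec_carrier] by blast
  have "v = 0\<^sub>v (q * N)"
  proof (rule eq_vecI)
    fix i assume "i < dim_vec (0\<^sub>v (q * N) :: complex vec)"
    then have i: "i < q * N" by simp
    then have N: "N > 0" by (metis gr0I mult_0_right not_less0)
    have "i div N < q" using i by (simp add: less_mult_imp_div_less)
    then have "slice_vec N (i div N) v $ (i mod N) = 0"
      using z N by simp
    then show "v $ i = 0\<^sub>v (q * N) $ i"
      using i N unfolding slice_vec_def by simp
  qed (use assms in auto)
  with assms show False by simp
qed

text \<open>The operator \<open>M \<otimes> |a\<rangle>\<langle>a|\<close> for \<open>M = tensor_op q m T A local_id\<close>.\<close>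

definition tensor_proj :: "nat \<Rightarrow> nat \<Rightarrow> nat set \<Rightarrow> local_op \<Rightarrow> nat \<Rightarrow> complex mat" where
  "tensor_proj q m T A a = tensor_op q (Suc m) (insert m T)
     (\<lambda>x y. if x m = a \<and> y m = a then A (restrict x T) (restrict y T) else 0) local_id"

text \<open>The last digit of an index is its quotient by \<open>q ^ m\<close>, so
  \<open>tensor_proj\<close> vanishes outside block \<open>a\<close>. Inside it, adding
  \<open>a * q ^ m\<close> leaves the lower digits unchanged, so the entries agree.\<close>

lemma braket_slice_tensor_op:
  assumes u: "u \<in> carrier_vec (q ^ Suc m)" and v: "v \<in> carrier_vec (q ^ Suc m)"
    and a: "a < q" and T: "T \<subseteq> {..<m}"
  shows "braket (slice_vec (q ^ m) a u) (tensor_op q m T A local_id) (slice_vec (q ^ m) a v) =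
    braket u (tensor_proj q m T A a) v"
proof (rule braket_slice_vec[OF _ _ a])
  have mT: "m \<notin> T" using T by auto
  have compl: "{..<Suc m} - insert m T = {..<m} - T" by auto
  have last: "digits_on q (insert m T) i m = digit q m i" for i
    by (simp add: digits_on_def)
  have front: "restrict (digits_on q (insert m T) i) T = digits_on q T i" for i
    by (auto simp: digits_on_def restrict_def)
  {
    fix i j assume "i < q * q ^ m" "j < q * q ^ m" "i div q ^ m \<noteq> a \<or> j div q ^ m \<noteq> a"
    then show "tensor_proj q m T A a $$ (i, j) = 0"
      unfolding tensor_proj_def by (subst tensor_op_index) (auto simp: last digit_last)
  }
  {
    fix i j assume ij: "i < q ^ m" "j < q ^ m"
    have less: "i + a * q ^ m < q ^ Suc m" "j + a * q ^ m < q ^ Suc m"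
      using slice_index_less[OF ij(1) a] slice_index_less[OF ij(2) a] by simp_all
    have "digit q k (l + a * q ^ m) = digit q k l" if "k < m" for k l
      using that a by (intro digit_add_last) auto
    then have low: "\<And>k l. k \<in> {..<m} - T \<Longrightarrow> digit q k (l + a * q ^ m) = digit q k l"
      and on: "\<And>l. digits_on q T (l + a * q ^ m) = digits_on q T l"
      using T by (auto simp: digits_on_eq_iff)
    show "tensor_proj q m T A a $$ (i + a * q ^ m, j + a * q ^ m) =
        tensor_op q m T A local_id $$ (i, j)"
      unfolding tensor_proj_def
      using less ij a
      by (simp only: tensor_op_index compl last front digit_last low on) 
        (simp add: low)
  }
qed (use u v tensor_op_carrier[of q "Suc m"] in \<open>auto simp: tensor_proj_def\<close>)

theorem ex_qecc_puncture:
  assumes "qecc q (Suc m) K d C" "d > 1"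
  shows "\<exists>C'. qecc q m K (d - 1) C'"
proof -
  from assms(1) have "\<exists>C. qecc q (Suc m) K d C" by blast
  then obtain cs where K: "K > 1" "length cs = K"
    and car: "set cs \<subseteq> carrier_vec (q ^ Suc m)"
    and on: "orthonormal cs" and kl: "knill_laflamme q (Suc m) d cs"
    unfolding ex_qecc_iff by blast
  have car': "cs ! i \<in> carrier_vec (q ^ Suc m)" if "i < length cs" for i
    using car that by auto
  have proj: "scalar_on cs (tensor_proj q m T A a)" if T: "T \<subseteq> {..<m}" "card T < d - 1" for T A a
  proof -
    have "card (insert m T) \<le> Suc (card T)" by (rule card_insert_le_m1) auto
    then have "card (insert m T) < d" using T(2) by linarith
    moreover have "insert m T \<subseteq> {..<Suc m}" using T(1) by auto
    ultimately show ?thesis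
      using kl unfolding knill_laflamme_iff tensor_proj_def by blast
  qed
  define w where "w = slice_vec (q ^ m)"
  \<comment> \<open>One code vector suffices to choose \<open>a\<close>: all projected vectors turn
    out to have the same norm.\<close>
  have "cs ! 0 \<bullet>c cs ! 0 \<noteq> 0" using on K unfolding orthonormal_def by simp
  then obtain a where a: "a < q" "w a (cs ! 0) \<bullet>c w a (cs ! 0) \<noteq> 0"
    using ex_slice_vec_nonzero[of "cs ! 0" q "q ^ m"] car'[of 0] K unfolding w_def by auto
  define \<alpha> where "\<alpha> = w a (cs ! 0) \<bullet>c w a (cs ! 0)"
  \<comment> \<open>The root is taken of the real part because \<alpha> has complex type; that
    \<alpha> is real and positive follows below.\<close>
  define s where "s = complex_of_real (1 / sqrt (Re \<alpha>))"
  have "\<alpha> \<ge> 0" unfolding \<alpha>_def by (rule conjugate_square_ge_0_vec)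
  then have "\<alpha> = complex_of_real (Re \<alpha>)" "Re \<alpha> \<ge> 0"
    by (auto simp: complex_eq_iff less_eq_complex_def)
  moreover from this have "Re \<alpha> > 0" using a(2) unfolding \<alpha>_def[symmetric]
    by (metis less_eq_real_def of_real_0)
  moreover have "s * cnj s = complex_of_real (1 / Re \<alpha>)"
    unfolding s_def using \<open>Re \<alpha> \<ge> 0\<close> 
    by (simp flip: of_real_mult)
  ultimately have s: "s * cnj s * \<alpha> = 1"
    by (metis less_irrefl nonzero_eq_divide_eq of_real_1 of_real_mult)
  let ?f = "\<lambda>u. s \<cdot>\<^sub>v w a u"
  let ?cs = "map ?f cs"
  have bk: "braket (?f u) (tensor_op q m T A local_id) (?f v) =
      (s * cnj s) * braket u (tensor_proj q m T A a) v"
    if "u \<in> set cs" "v \<in> set cs" "T \<subseteq> {..<m}" for u v T A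
  proof -
    have "u \<in> carrier_vec (q ^ Suc m)" "v \<in> carrier_vec (q ^ Suc m)" using that car by auto
    then show ?thesis
      unfolding w_def using a(1) that(3)
      by (simp only: braket_smult[OF slice_vec_carrier slice_vec_carrier tensor_op_carrier]
          braket_slice_tensor_op)
  qed
  have "orthonormal ?cs"
    unfolding orthonormal_def length_map
  proof (intro allI impI)
    fix i j assume ij: "i < length cs" "j < length cs"
    \<comment> \<open>\<open>?P\<close> is the identity tensored with |a><a|, so its brakets are the
      inner products of the projected vectors. Its empty support needs \<open>0 < d - 1\<close>,
      which is where \<open>d > 1\<close> enters.\<close>
    let ?P = "tensor_proj q m {} (\<lambda>_ _. 1) a"
    have P: "scalar_on cs ?P" using assms(2) by (intro proj) auto
    have ip: "braket u ?P v = w a v \<bullet>c w a u" if "u \<in> set cs" "v \<in> set cs" for u v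
      using braket_slice_tensor_op[of u q m v a "{}" "\<lambda>_ _. 1"] car[THEN subsetD, OF that(1)]
        car[THEN subsetD, OF that(2)] a(1)
      by (simp add: tensor_op_empty braket_one w_def del: power_Suc)
    have "braket (cs ! 0) ?P (cs ! 0) = \<alpha>"
      using K unfolding \<alpha>_def by (intro ip) auto
    \<comment> \<open>Comparison with index 0 identifies the common diagonal value as
      \<alpha>.\<close>
    then have "braket (cs ! i) ?P (cs ! j) = (if i = j then \<alpha> else 0)"
      using P[unfolded scalar_on_def, rule_format, of i j]
        P[unfolded scalar_on_def, rule_format, of i 0] ij K by auto
    then show "?cs ! j \<bullet>c ?cs ! i = (if i = j then 1 else 0)"
      using bk[of "cs ! i" "cs ! j" "{}" "\<lambda>_ _. 1"] ij s
      by (auto simp: tensor_op_empty braket_one w_def)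
  qed
  moreover have "knill_laflamme q m (d - 1) ?cs"
    unfolding knill_laflamme_iff
    by (intro allI impI scalar_on_mapI[OF bk proj])
  moreover have "set ?cs \<subseteq> carrier_vec (q ^ m)" by (auto simp: w_def)
  ultimately have "length ?cs = K \<and> set ?cs \<subseteq> carrier_vec (q ^ m) \<and>
      orthonormal ?cs \<and> knill_laflamme q m (d - 1) ?cs"
    using K by simp
  then show ?thesis using K(1) unfolding ex_qecc_iff by blast
qed

section \<open>Positive length and the three constructions together\<close>

text \<open>In dimension \<open>q ^ 0 = 1\<close> there are no two orthogonal unit vectors.\<close>

lemma qecc_length_pos:
  assumes "qecc q n K d C"
  shows "n > 0"
proof (rule ccontr)
  assume "\<not> n > 0"
  then have n: "n = 0" by simp
  from assms have "\<exists>C. qecc q n K d C" by blast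
  then obtain cs where K: "K > 1" "length cs = K" and car: "set cs \<subseteq> carrier_vec (q ^ n)"
    and on: "orthonormal cs"
    unfolding ex_qecc_iff by blast
  have c: "cs ! 0 \<in> carrier_vec 1" "cs ! 1 \<in> carrier_vec 1"
    using car[THEN subsetD, OF nth_mem] K n by auto
  have "cs ! 0 \<bullet>c cs ! 0 = 1" "cs ! 1 \<bullet>c cs ! 1 = 1" "cs ! 1 \<bullet>c cs ! 0 = 0"
    using on K unfolding orthonormal_def by auto
  \<comment> \<open>In dimension 1 an inner product is a single product of complex numbers; if it is
    0, one of the vectors is 0, against norm 1.\<close>
  then show False using c by (auto simp: cscalar_prod_sum[of _ 1])
qed

theorem theorem4p1:
  fixes q n K d :: nat and C :: "complex vec set"
  assumes "q \<ge> 2" and "qecc q n K d C" and "d > 1"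
  shows "(\<forall>K'. 1 < K' \<and> K' \<le> K \<longrightarrow> (\<exists>C'. qecc q n K' d C')) \<and>
         (\<forall>n'\<ge>n. \<exists>C'. qecc q n' K d C') \<and>
         (\<exists>C'. qecc q (n - 1) K (d - 1) C')"
proof (intro conjI allI impI)
  show "\<exists>C'. qecc q n K' d C'" if "1 < K' \<and> K' \<le> K" for K'
    using that ex_qecc_subcode[OF assms(2)] by blast
  show "\<exists>C'. qecc q n' K d C'" if "n \<le> n'" for n'
    using assms(1) that by (intro ex_qecc_lengthen[OF _ assms(2)]) auto
  \<comment> \<open>Positive length makes \<open>n - 1\<close> a true predecessor and not a
    subtraction truncated at 0.\<close>
  have "n = Suc (n - 1)" using qecc_length_pos[OF assms(2)] by simp
  then show "\<exists>C'. qecc q (n - 1) K (d - 1) C'"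
    using assms(2,3) ex_qecc_puncture[of q "n - 1" K d C] by simp
qed

end
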